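(* Let $\lambda X$ be a pure type system with specification $(\mathcal S,\mathcal A,\mathcal R)$. Suppose there are $n\in\mathbb N$ with $n>1$ and sorts $s_1,\dots,s_n\in\mathcal S$ such that $s_1=s_n\in\mathcal N$ and for each $1\le i<n$ there is $s'\in\mathcal I$ with $(s',s_i,s_{i+1})\in\mathcal R$; and suppose moreover that for all $(s_1',s_2',s_3')\in\mathcal R$ we have $(s_1:s_2')\notin\mathcal A$. Then there is no Hilbert-style pure type system equivalent to $\lambda X$.
   Context: Pure type systems (PTS). A PTS has an infinite set $V$ of variables, a set $\mathcal C$ of constants, a set of sorts $\mathcal S\subseteq\mathcal C$, axioms $\mathcal A$ of the form $c:s$ ($c\in\mathcal C,s\in\mathcal S$) and rules $\mathcal R\subseteq\mathcal S^3$. Pseudoterms: $\mathcal T::=V\mid\mathcal C\mid\Pi V{:}\mathcal T.\mathcal T\mid\lambda V{:}\mathcal T.\mathcal T\mid\mathcal T\mathcal T$. Judgements $\Gamma\vdash M:A$ with $\Gamma$ a finite sequence of declarations $x:A$. Rules: (axiom) $\vdash c:s$ for $(c:s)\in\mathcal A$; (start) from $\Gamma\vdash A:s$ infer $\Gamma,x:A\vdash x:A$ ($x$ fresh); (weakening) from $\Gamma\vdash M:B$ and $\Gamma\vdash A:s$ infer $\Gamma,x:A\vdash M:B$ ($x$ fresh); (application) from $\Gamma\vdash M:(\Pi x{:}A.B)$ and $\Gamma\vdash N:A$ infer $\Gamma\vdash MN:B[x:=N]$; (abstraction) from $\Gamma,x:A\vdash M:B$ and $\Gamma\vdash(\Pi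 x{:}A.B):s$ infer $\Gamma\vdash(\lambda x{:}A.M):(\Pi x{:}A.B)$; (product) from $\Gamma,x:A\vdash B:s_2$, $\Gamma\vdash A:s_1$, $(s_1,s_2,s_3)\in\mathcal R$ infer $\Gamma\vdash(\Pi x{:}A.B):s_3$; (conversion) from $\Gamma\vdash M:A$, $\Gamma\vdash B:s$, $A=_\beta B$ infer $\Gamma\vdash M:B$ (here $s,s_i$ range over $\mathcal S$). A sort $s$ is inhabited ($s\in\mathcal I$) if $\vdash A:s$ is derivable for some $A$; it is normal form inhabited ($s\in\mathcal N$) if $\vdash A:s$ for some $A$ in $\beta$-normal form. Hilbert-style PTS (HPTS): same $V,\mathcal C,\mathcal S,\mathcal T$, only empty contexts, axioms $\mathcal A$ plus a finite set $\mathcal B$ of axiom schemes (judgements $\vdash M:A$ whose sort variables may be instantiated by sorts); rules: the axioms, (application) and (conversion) with empty contexts, (type reduction) from $\vdash M:A$ and $A\to_\beta B$ infer $\vdash M:B$, and (subject reduction) from $\vdash M:A$ and $M\to_\beta N$ infer $\vdash N:A$. An HPTS with specification $(\mathcal S,\mathcal A,\mathcal B)$ is equivalent to the PTS $(\mathcal S,\mathcal A,\mathcal R)$ if for all $M,A$: $\vdash M:A$ is derivable in the PTS iff it is derivable in the HPTS. *)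

theory Defs
  imports Main
begin

text \<open>Pseudoterms are represented modulo \<open>\<alpha>\<close>-equivalence by de Bruijn indices; the type
  variable \<open>'c\<close> is the set of constants.  In \<open>Prd A B\<close> (the product \<open>\<Pi>x:A. B\<close>) and
  \<open>Lam A M\<close> (the abstraction \<open>\<lambda>x:A. M\<close>) the index 0 is bound in the second argument only.\<close>

datatype 'c pterm =
    Var nat
  | Cst 'c
  | Prd "'c pterm" "'c pterm"
  | Lam "'c pterm" "'c pterm"
  | App "'c pterm" "'c pterm"

primrec lift :: "nat \<Rightarrow> 'c pterm \<Rightarrow> 'c pterm" where
  "lift k (Var i) = (if i < k then Var i else Var (Suc i))"
| "lift k (Cst c) = Cst c"
| "lift k (Prd A B) = Prd (lift k A) (lift (Suc k) B)"
| "lift k (Lam A M) = Lam (lift k A) (lift (Suc k) M)"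
| "lift k (App M N) = App (lift k M) (lift k N)"

text \<open>\<open>subst k N M\<close> replaces index \<open>k\<close> in \<open>M\<close> by \<open>N\<close> and lowers the indices above \<open>k\<close>,
  so \<open>subst 0 N B\<close> is \<open>B[x:=N]\<close> for the variable \<open>x\<close> that a binder around \<open>B\<close> binds.\<close>

primrec subst :: "nat \<Rightarrow> 'c pterm \<Rightarrow> 'c pterm \<Rightarrow> 'c pterm" where
  "subst k N (Var i) = (if i < k then Var i else if i = k then N else Var (i - 1))"
| "subst k N (Cst c) = Cst c"
| "subst k N (Prd A B) = Prd (subst k N A) (subst (Suc k) (lift 0 N) B)"
| "subst k N (Lam A M) = Lam (subst k N A) (subst (Suc k) (lift 0 N) M)"
| "subst k N (App M P) = App (subst k N M) (subst k N P)"

inductive beta :: "'c pterm \<Rightarrow> 'c pterm \<Rightarrow> bool"  (infix \<open>\<rightarrow>\<^sub>\<beta>\<close> 50) where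
  beta: "App (Lam A M) N \<rightarrow>\<^sub>\<beta> subst 0 N M"
| Prd1: "A \<rightarrow>\<^sub>\<beta> A' \<Longrightarrow> Prd A B \<rightarrow>\<^sub>\<beta> Prd A' B"
| Prd2: "B \<rightarrow>\<^sub>\<beta> B' \<Longrightarrow> Prd A B \<rightarrow>\<^sub>\<beta> Prd A B'"
| Lam1: "A \<rightarrow>\<^sub>\<beta> A' \<Longrightarrow> Lam A M \<rightarrow>\<^sub>\<beta> Lam A' M"
| Lam2: "M \<rightarrow>\<^sub>\<beta> M' \<Longrightarrow> Lam A M \<rightarrow>\<^sub>\<beta> Lam A M'"
| App1: "M \<rightarrow>\<^sub>\<beta> M' \<Longrightarrow> App M N \<rightarrow>\<^sub>\<beta> App M' N"
| App2: "N \<rightarrow>\<^sub>\<beta> N' \<Longrightarrow> App M N \<rightarrow>\<^sub>\<beta> App M N'"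

abbreviation beta_eq :: "'c pterm \<Rightarrow> 'c pterm \<Rightarrow> bool"  (infix \<open>=\<^sub>\<beta>\<close> 50) where
  "M =\<^sub>\<beta> N \<equiv> equivclp beta M N"

definition beta_normal :: "'c pterm \<Rightarrow> bool" where
  "beta_normal M \<longleftrightarrow> (\<nexists>N. M \<rightarrow>\<^sub>\<beta> N)"

definition pts_spec :: "'c set \<Rightarrow> ('c \<times> 'c) set \<Rightarrow> ('c \<times> 'c \<times> 'c) set \<Rightarrow> bool" where
  "pts_spec S Ax R \<longleftrightarrow> Ax \<subseteq> UNIV \<times> S \<and> R \<subseteq> S \<times> S \<times> S"

text \<open>Contexts are lists whose head is the most recent declaration; each type in a context
  lives over the declarations to its right, which is why \<open>start\<close> and \<open>weakening\<close> lift.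
  Freshness of the declared variable is automatic.\<close>

inductive pts :: "'c set \<Rightarrow> ('c \<times> 'c) set \<Rightarrow> ('c \<times> 'c \<times> 'c) set
    \<Rightarrow> 'c pterm list \<Rightarrow> 'c pterm \<Rightarrow> 'c pterm \<Rightarrow> bool"
  for S :: "'c set" and Ax :: "('c \<times> 'c) set" and R :: "('c \<times> 'c \<times> 'c) set"
where
  axiom: "(c, s) \<in> Ax \<Longrightarrow> pts S Ax R [] (Cst c) (Cst s)"
| start: "\<lbrakk>pts S Ax R \<Gamma> A (Cst s); s \<in> S\<rbrakk>
    \<Longrightarrow> pts S Ax R (A # \<Gamma>) (Var 0) (lift 0 A)"
| weakening: "\<lbrakk>pts S Ax R \<Gamma> M B; pts S Ax R \<Gamma> A (Cst s); s \<in> S\<rbrakk>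
    \<Longrightarrow> pts S Ax R (A # \<Gamma>) (lift 0 M) (lift 0 B)"
| application: "\<lbrakk>pts S Ax R \<Gamma> M (Prd A B); pts S Ax R \<Gamma> N A\<rbrakk>
    \<Longrightarrow> pts S Ax R \<Gamma> (App M N) (subst 0 N B)"
| abstraction: "\<lbrakk>pts S Ax R (A # \<Gamma>) M B; pts S Ax R \<Gamma> (Prd A B) (Cst s); s \<in> S\<rbrakk>
    \<Longrightarrow> pts S Ax R \<Gamma> (Lam A M) (Prd A B)"
| product: "\<lbrakk>pts S Ax R (A # \<Gamma>) B (Cst s2); pts S Ax R \<Gamma> A (Cst s1); (s1, s2, s3) \<in> R\<rbrakk>
    \<Longrightarrow> pts S Ax R \<Gamma> (Prd A B) (Cst s3)"
| conversion: "\<lbrakk>pts S Ax R \<Gamma> M A; pts S Ax R \<Gamma> B (Cst s); s \<in> S; A =\<^sub>\<beta> B\<rbrakk>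
    \<Longrightarrow> pts S Ax R \<Gamma> M B"

definition inhabited_sorts :: "'c set \<Rightarrow> ('c \<times> 'c) set \<Rightarrow> ('c \<times> 'c \<times> 'c) set \<Rightarrow> 'c set" where
  "inhabited_sorts S Ax R = {s \<in> S. \<exists>A. pts S Ax R [] A (Cst s)}"

definition nf_inhabited_sorts :: "'c set \<Rightarrow> ('c \<times> 'c) set \<Rightarrow> ('c \<times> 'c \<times> 'c) set \<Rightarrow> 'c set" where
  "nf_inhabited_sorts S Ax R = {s \<in> S. \<exists>A. beta_normal A \<and> pts S Ax R [] A (Cst s)}"

text \<open>An axiom scheme is a judgement \<open>\<turnstile> M : A\<close> whose atoms are either constants (\<open>Inl c\<close>) or
  sort variables (\<open>Inr v\<close>).  Only the sort variables that occur in the scheme have to be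
  instantiated by sorts, so a scheme without sort variables has itself as an instance even
  if there are no sorts.\<close>

type_synonym 'c scheme = "('c + nat) pterm \<times> ('c + nat) pterm"

definition inst :: "(nat \<Rightarrow> 'c) \<Rightarrow> ('c + nat) pterm \<Rightarrow> 'c pterm" where
  "inst \<sigma> = map_pterm (case_sum (\<lambda>c. c) \<sigma>)"

definition sort_vars :: "('c + nat) pterm \<Rightarrow> nat set" where
  "sort_vars M = {v. Inr v \<in> set_pterm M}"

definition hpts_spec :: "'c set \<Rightarrow> ('c \<times> 'c) set \<Rightarrow> 'c scheme set \<Rightarrow> bool" where
  "hpts_spec S Ax \<B> \<longleftrightarrow> Ax \<subseteq> UNIV \<times> S \<and> finite \<B>"

inductive hpts :: "'c set \<Rightarrow> ('c \<times> 'c) set \<Rightarrow> 'c scheme set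
    \<Rightarrow> 'c pterm \<Rightarrow> 'c pterm \<Rightarrow> bool"
  for S :: "'c set" and Ax :: "('c \<times> 'c) set" and \<B> :: "'c scheme set"
where
  axiom: "(c, s) \<in> Ax \<Longrightarrow> hpts S Ax \<B> (Cst c) (Cst s)"
| scheme: "\<lbrakk>(M, A) \<in> \<B>; \<And>v. v \<in> sort_vars M \<union> sort_vars A \<Longrightarrow> \<sigma> v \<in> S\<rbrakk>
    \<Longrightarrow> hpts S Ax \<B> (inst \<sigma> M) (inst \<sigma> A)"
| application: "\<lbrakk>hpts S Ax \<B> M (Prd A B); hpts S Ax \<B> N A\<rbrakk>
    \<Longrightarrow> hpts S Ax \<B> (App M N) (subst 0 N B)"
| conversion: "\<lbrakk>hpts S Ax \<B> M A; hpts S Ax \<B> B (Cst s); s \<in> S; A =\<^sub>\<beta> B\<rbrakk>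
    \<Longrightarrow> hpts S Ax \<B> M B"
| type_reduction: "\<lbrakk>hpts S Ax \<B> M A; A \<rightarrow>\<^sub>\<beta> B\<rbrakk> \<Longrightarrow> hpts S Ax \<B> M B"
| subject_reduction: "\<lbrakk>hpts S Ax \<B> M A; M \<rightarrow>\<^sub>\<beta> N\<rbrakk> \<Longrightarrow> hpts S Ax \<B> N A"

definition hpts_equivalent ::
    "'c set \<Rightarrow> ('c \<times> 'c) set \<Rightarrow> 'c scheme set \<Rightarrow> ('c \<times> 'c \<times> 'c) set \<Rightarrow> bool" where
  "hpts_equivalent S Ax \<B> R \<longleftrightarrow> (\<forall>M A. pts S Ax R [] M A \<longleftrightarrow> hpts S Ax \<B> M A)"

end

theory Submission
  imports Defs
begin

text \<open>
  Write \<open>s\<close> for the sort \<open>s 1\<close>. In an equivalent Hilbert-style system a term whose type converts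
  to \<open>s\<close> never comes from an application: if \<open>M : \<Pi>x:A. B\<close>, \<open>N : A\<close> and \<open>B[x:=N]\<close> reduces to
  \<open>s\<close>, then \<open>B : t\<close> for the second component \<open>t\<close> of some rule, so \<open>B[x:=N] : t\<close> and, by subject
  reduction (which need not be proved for the PTS, being a rule of the Hilbert-style system),
  \<open>s : t\<close> is an axiom, which is excluded. Hence every inhabitant of \<open>s\<close> is a constant or a reduct
  of an instance of one of the finitely many schemes.

  On the other hand, going round the cycle of rules produces inhabitants
  \<open>\<Pi>x\<^sub>1:A\<^sub>1. \<dots> \<Pi>x\<^sub>m:A\<^sub>m. N\<close> of \<open>s\<close> with \<open>N\<close> normal and \<open>m\<close> arbitrarily large. As \<open>N\<close> is
  normal, reduction does not change the length of such a prefix, so by confluence all terms of this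
  shape that are reducts of instances of one scheme have the same length. This holds for all
  instances simultaneously, since reductions of an instance come from reductions of the scheme.
\<close>

section \<open>Lifting and substitution\<close>

lemma lift_lift: "i \<le> k \<Longrightarrow> lift (Suc k) (lift i t) = lift i (lift k t)"
  by (induction t arbitrary: i k) auto

lemma subst_lift [simp]: "subst k N (lift k t) = t"
  by (induction t arbitrary: k N) auto

lemma lift_subst_le: "i \<le> k \<Longrightarrow> lift i (subst k N t) = subst (Suc k) (lift i N) (lift i t)"
  by (induction t arbitrary: i k N) (auto simp: lift_lift)

lemma lift_subst_ge: "k \<le> i \<Longrightarrow> lift i (subst k N t) = subst k (lift i N) (lift (Suc i) t)"
  by (induction t arbitrary: i k N) (auto simp: lift_lift)

text \<open>The substitution lemma in de Bruijn form. On the right the substitution for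
  \<open>k\<close> acts first, while index \<open>i\<close> is still present, which accounts for
  \<open>Suc k\<close> and \<open>lift i P\<close>.\<close>

lemma subst_subst:
  "i \<le> k \<Longrightarrow> subst k P (subst i N t) = subst i (subst k P N) (subst (Suc k) (lift i P) t)"
  by (induction t arbitrary: i k N P) (auto simp: lift_lift lift_subst_le)

lemma map_pterm_lift: "map_pterm f (lift k t) = lift k (map_pterm f t)"
  by (induction t arbitrary: k) auto

lemma map_pterm_subst: "map_pterm f (subst k N t) = subst k (map_pterm f N) (map_pterm f t)"
  by (induction t arbitrary: k N) (auto simp: map_pterm_lift)

section \<open>Confluence\<close>

lemma beta_lift: "M \<rightarrow>\<^sub>\<beta> N \<Longrightarrow> lift k M \<rightarrow>\<^sub>\<beta> lift k N"
proof (induction arbitrary: k rule: beta.induct)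
  case (beta A M N)
  show ?case using beta.beta[of "lift k A" "lift (Suc k) M" "lift k N"]
    by (simp add: lift_subst_ge)
qed (auto intro: beta.intros)

lemma beta_subst: "M \<rightarrow>\<^sub>\<beta> N \<Longrightarrow> subst k P M \<rightarrow>\<^sub>\<beta> subst k P N"
proof (induction arbitrary: k P rule: beta.induct)
  case (beta A M N)
  show ?case using beta.beta[of "subst k P A" "subst (Suc k) (lift 0 P) M" "subst k P N"]
    by (simp add: subst_subst)
qed (auto intro: beta.intros)

lemma equivclp_map:
  assumes "\<And>x y. r x y \<Longrightarrow> r' (f x) (f y)" and "equivclp r x y"
  shows "equivclp r' (f x) (f y)"
  using assms(2)
proof (induction rule: equivclp_induct)
  case (step y z)
  then show ?case
    using assms(1) by (blast intro: equivclp_trans r_into_equivclp equivclp_sym)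
qed simp

lemma beta_eq_lift: "M =\<^sub>\<beta> N \<Longrightarrow> lift k M =\<^sub>\<beta> lift k N"
  by (rule equivclp_map[where f = "lift k"]) (rule beta_lift)

lemma beta_eq_subst: "M =\<^sub>\<beta> N \<Longrightarrow> subst k P M =\<^sub>\<beta> subst k P N"
  by (rule equivclp_map[where f = "subst k P"]) (rule beta_subst)

section \<open>Parallel reduction and complete developments\<close>

inductive par :: "'c pterm \<Rightarrow> 'c pterm \<Rightarrow> bool"  (infix \<open>\<Rightarrow>\<^sub>\<beta>\<close> 50) where
  Var: "Var i \<Rightarrow>\<^sub>\<beta> Var i"
| Cst: "Cst c \<Rightarrow>\<^sub>\<beta> Cst c"
| Prd: "A \<Rightarrow>\<^sub>\<beta> A' \<Longrightarrow> B \<Rightarrow>\<^sub>\<beta> B' \<Longrightarrow> Prd A B \<Rightarrow>\<^sub>\<beta> Prd A' B'"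
| Lam: "A \<Rightarrow>\<^sub>\<beta> A' \<Longrightarrow> M \<Rightarrow>\<^sub>\<beta> M' \<Longrightarrow> Lam A M \<Rightarrow>\<^sub>\<beta> Lam A' M'"
| App: "M \<Rightarrow>\<^sub>\<beta> M' \<Longrightarrow> N \<Rightarrow>\<^sub>\<beta> N' \<Longrightarrow> App M N \<Rightarrow>\<^sub>\<beta> App M' N'"
| beta: "M \<Rightarrow>\<^sub>\<beta> M' \<Longrightarrow> N \<Rightarrow>\<^sub>\<beta> N' \<Longrightarrow> App (Lam A M) N \<Rightarrow>\<^sub>\<beta> subst 0 N' M'"

inductive_cases par_LamE: "Lam A M \<Rightarrow>\<^sub>\<beta> P"

lemma par_refl [simp]: "M \<Rightarrow>\<^sub>\<beta> M"
  by (induction M) (auto intro: par.intros)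

lemma beta_imp_par: "M \<rightarrow>\<^sub>\<beta> N \<Longrightarrow> M \<Rightarrow>\<^sub>\<beta> N"
  by (induction rule: beta.induct) (auto intro: par.intros)

lemma rtranclp_map:
  assumes "\<And>x y. r x y \<Longrightarrow> r' (f x) (f y)" and "r\<^sup>*\<^sup>* x y"
  shows "r'\<^sup>*\<^sup>* (f x) (f y)"
  using assms(2)
  by (induction rule: rtranclp_induct) (auto intro: assms(1) rtranclp.rtrancl_into_rtrancl)

lemma par_imp_betas: "M \<Rightarrow>\<^sub>\<beta> N \<Longrightarrow> beta\<^sup>*\<^sup>* M N"
proof (induction rule: par.induct)
  case (Prd A A' B B')
  have "beta\<^sup>*\<^sup>* (Prd A B) (Prd A' B)"
    by (rule rtranclp_map[where f = "\<lambda>A. Prd A B", OF _ Prd.IH(1)]) (rule beta.intros)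
  also have "beta\<^sup>*\<^sup>* (Prd A' B) (Prd A' B')"
    by (rule rtranclp_map[where f = "Prd A'", OF _ Prd.IH(2)]) (rule beta.intros)
  finally show ?case .
next
  case (Lam A A' M M')
  have "beta\<^sup>*\<^sup>* (Lam A M) (Lam A' M)"
    by (rule rtranclp_map[where f = "\<lambda>A. Lam A M", OF _ Lam.IH(1)]) (rule beta.intros)
  also have "beta\<^sup>*\<^sup>* (Lam A' M) (Lam A' M')"
    by (rule rtranclp_map[where f = "Lam A'", OF _ Lam.IH(2)]) (rule beta.intros)
  finally show ?case .
next
  case (App M M' N N')
  have "beta\<^sup>*\<^sup>* (App M N) (App M' N)"
    by (rule rtranclp_map[where f = "\<lambda>M. App M N", OF _ App.IH(1)]) (rule beta.intros)
  also have "beta\<^sup>*\<^sup>* (App M' N) (App M' N')"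
    by (rule rtranclp_map[where f = "App M'", OF _ App.IH(2)]) (rule beta.intros)
  finally show ?case .
next
  case (beta M M' N N' A)
  have "beta\<^sup>*\<^sup>* (App (Lam A M) N) (App (Lam A M') N)"
    by (rule rtranclp_map[where f = "\<lambda>M. App (Lam A M) N", OF _ beta.IH(1)])
      (intro beta.intros)
  also have "beta\<^sup>*\<^sup>* (App (Lam A M') N) (App (Lam A M') N')"
    by (rule rtranclp_map[where f = "App (Lam A M')", OF _ beta.IH(2)]) (rule beta.intros)
  also have "beta\<^sup>*\<^sup>* (App (Lam A M') N') (subst 0 N' M')"
    by (blast intro: beta.beta)
  finally show ?case .
qed auto

lemma par_lift: "M \<Rightarrow>\<^sub>\<beta> N \<Longrightarrow> lift k M \<Rightarrow>\<^sub>\<beta> lift k N"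
  by (induction arbitrary: k rule: par.induct) (auto simp: lift_subst_ge intro: par.intros)

lemma par_subst:
  "M \<Rightarrow>\<^sub>\<beta> M' \<Longrightarrow> N \<Rightarrow>\<^sub>\<beta> N' \<Longrightarrow> subst k N M \<Rightarrow>\<^sub>\<beta> subst k N' M'"
proof (induction arbitrary: k N N' rule: par.induct)
  case (Prd A A' B B')
  then show ?case by (simp add: par.Prd par_lift)
next
  case (Lam A A' M M')
  then show ?case by (simp add: par.Lam par_lift)
next
  case (App M M' P P')
  then show ?case by (simp add: par.App)
next
  case (beta M M' P P' A)
  then show ?case by (simp add: subst_subst par.beta par_lift)
qed auto

text \<open>Takahashi's complete development: all redexes present in the term are contracted at
  once.\<close>

fun complete_dev :: "'c pterm \<Rightarrow> 'c pterm" where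
  "complete_dev (Var i) = Var i"
| "complete_dev (Cst c) = Cst c"
| "complete_dev (Prd A B) = Prd (complete_dev A) (complete_dev B)"
| "complete_dev (Lam A M) = Lam (complete_dev A) (complete_dev M)"
| "complete_dev (App (Lam A M) N) = subst 0 (complete_dev N) (complete_dev M)"
| "complete_dev (App M N) = App (complete_dev M) (complete_dev N)"

text \<open>The triangle property. The target depends on \<open>M\<close> alone, so any two parallel
  reducts of \<open>M\<close> meet there, which is the diamond property.\<close>

lemma par_complete_dev: "M \<Rightarrow>\<^sub>\<beta> N \<Longrightarrow> N \<Rightarrow>\<^sub>\<beta> complete_dev M"
proof (induction rule: par.induct)
  case (App M M' N N')
  show ?case
  proof (cases "\<exists>A P. M = Lam A P")
    case True
    then obtain A P where M: "M = Lam A P" by blast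
    \<comment> \<open>A parallel reduct of an abstraction is an abstraction, so the redex survives
      in \<open>App M' N'\<close> and can still be contracted.\<close>
    with App.hyps obtain A' P' where M': "M' = Lam A' P'" by (auto elim: par_LamE)
    from App.IH(1) M M' have "P' \<Rightarrow>\<^sub>\<beta> complete_dev P" by (auto elim: par_LamE)
    with App.IH(2) show ?thesis by (simp add: M M' par.beta)
  next
    case False
    then have "complete_dev (App M N) = App (complete_dev M) (complete_dev N)"
      by (cases M) auto
    with App.IH show ?thesis by (simp add: par.App)
  qed
qed (auto intro: par.intros par_subst)

lemma pars_eq_betas: "par\<^sup>*\<^sup>* = beta\<^sup>*\<^sup>*"
proof (intro ext iffI)
  fix M N :: "'a pterm"
  show "par\<^sup>*\<^sup>* M N \<Longrightarrow> beta\<^sup>*\<^sup>* M N"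
    by (induction rule: rtranclp_induct) (auto dest: par_imp_betas)
  show "beta\<^sup>*\<^sup>* M N \<Longrightarrow> par\<^sup>*\<^sup>* M N"
    by (rule rtranclp_map[where f = "\<lambda>x. x"]) (auto intro: beta_imp_par)
qed

lemma par_strip: "par\<^sup>*\<^sup>* M P \<Longrightarrow> M \<Rightarrow>\<^sub>\<beta> N \<Longrightarrow> \<exists>Q. par\<^sup>*\<^sup>* N Q \<and> P \<Rightarrow>\<^sub>\<beta> Q"
  by (induction rule: rtranclp_induct)
    (blast intro: par_complete_dev rtranclp.rtrancl_into_rtrancl)+

lemma par_confluent: "par\<^sup>*\<^sup>* M N \<Longrightarrow> par\<^sup>*\<^sup>* M P \<Longrightarrow> \<exists>Q. par\<^sup>*\<^sup>* N Q \<and> par\<^sup>*\<^sup>* P Q"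
proof (induction rule: rtranclp_induct)
  case (step N N')
  then obtain Q where "par\<^sup>*\<^sup>* N Q" "par\<^sup>*\<^sup>* P Q" by blast
  with par_strip[OF this(1) step.hyps(2)] show ?case
    by (meson rtranclp.rtrancl_into_rtrancl)
qed blast

lemmas beta_confluent = par_confluent[unfolded pars_eq_betas]

lemma beta_eq_joinable: "M =\<^sub>\<beta> N \<Longrightarrow> \<exists>Q. beta\<^sup>*\<^sup>* M Q \<and> beta\<^sup>*\<^sup>* N Q"
proof (induction rule: equivclp_induct)
  case (step N P)
  then obtain Q where Q: "beta\<^sup>*\<^sup>* M Q" "beta\<^sup>*\<^sup>* N Q" by blast
  from step.hyps(2) show ?case
  proof
    assume "N \<rightarrow>\<^sub>\<beta> P"
    with beta_confluent[OF Q(2), of P] Q(1) show ?thesis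
      by (meson r_into_rtranclp rtranclp_trans)
  next
    assume "P \<rightarrow>\<^sub>\<beta> N"
    with Q show ?thesis by (meson converse_rtranclp_into_rtranclp)
  qed
qed blast

lemma beta_Cst_iff [simp]: "\<not> Cst c \<rightarrow>\<^sub>\<beta> M"
  by (auto elim: beta.cases)

lemma betas_Cst_iff [simp]: "beta\<^sup>*\<^sup>* (Cst c) M \<longleftrightarrow> M = Cst c"
  by (auto elim: converse_rtranclpE)

text \<open>Constants are normal, so the common reduct given by confluence is the constant
  itself.\<close>

lemma beta_eq_Cst: "M =\<^sub>\<beta> Cst c \<Longrightarrow> beta\<^sup>*\<^sup>* M (Cst c)"
  using beta_eq_joinable by fastforce

section \<open>Metatheory of pure type systems\<close>

text \<open>An entry with \<Delta> to its right sees a declaration inserted below \<Delta> at index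
  \<open>length \<Delta>\<close>; this fixes the cutoff here and the substituted index in
  \<open>subst_ctx\<close>.\<close>

primrec lift_ctx :: "'c pterm list \<Rightarrow> 'c pterm list" where
  "lift_ctx [] = []"
| "lift_ctx (A # \<Delta>) = lift (length \<Delta>) A # lift_ctx \<Delta>"

primrec subst_ctx :: "'c pterm \<Rightarrow> 'c pterm list \<Rightarrow> 'c pterm list" where
  "subst_ctx N [] = []"
| "subst_ctx N (A # \<Delta>) = subst (length \<Delta>) ((lift 0 ^^ length \<Delta>) N) A # subst_ctx N \<Delta>"

text \<open>The rule \<open>weakening\<close> adds a declaration only at the head. Inserting it
  below an arbitrary \<Delta> lets the induction pass the binders of \<open>abstraction\<close> and
  \<open>product\<close>.\<close>

lemma pts_thinning:
  assumes "pts S Ax R (\<Delta> @ \<Gamma>) M B" and D: "pts S Ax R \<Gamma> D (Cst s)" "s \<in> S"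
  shows "pts S Ax R (lift_ctx \<Delta> @ D # \<Gamma>) (lift (length \<Delta>) M) (lift (length \<Delta>) B)"
  using assms(1)
proof (induction "\<Delta> @ \<Gamma>" M B arbitrary: \<Delta> rule: pts.induct)
  case (axiom c s)
  then show ?case using D pts.weakening[OF pts.axiom] by fastforce
next
  case (start \<Gamma>' A t)
  show ?case
  proof (cases \<Delta>)
    case Nil
    with start have "pts S Ax R \<Gamma> (Var 0) (lift 0 A)"
      using pts.start[of S Ax R \<Gamma>' A t] by simp
    from pts.weakening[OF this D] Nil show ?thesis by simp
  next
    case (Cons A' \<Delta>')
    with start pts.start[of S Ax R "lift_ctx \<Delta>' @ D # \<Gamma>" "lift (length \<Delta>') A" t]
    show ?thesis by (simp add: lift_lift)
  qed
next
  case (weakening \<Gamma>' M B A t)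
  show ?case
  proof (cases \<Delta>)
    case Nil
    with weakening have "pts S Ax R \<Gamma> (lift 0 M) (lift 0 B)"
      using pts.weakening[of S Ax R \<Gamma>' M B A t] by simp
    from pts.weakening[OF this D] Nil show ?thesis by simp
  next
    case (Cons A' \<Delta>')
    with weakening show ?thesis
      using pts.weakening[of S Ax R "lift_ctx \<Delta>' @ D # \<Gamma>" "lift (length \<Delta>') M"
          "lift (length \<Delta>') B" "lift (length \<Delta>') A" t]
      by (simp add: lift_lift)
  qed
next
  case (application M A B N)
  then show ?case
    using pts.application[of S Ax R "lift_ctx \<Delta> @ D # \<Gamma>"] by (fastforce simp: lift_subst_ge)
next
  case (abstraction A M B t)
  from abstraction(2)[of "A # \<Delta>"] abstraction(4) abstraction(5) show ?case
    by (auto intro: pts.abstraction)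
next
  case (product A B s2 s1 s3)
  from product(2)[of "A # \<Delta>"] product(4) product(5) show ?case
    by (auto intro: pts.product)
next
  case (conversion M A B t)
  then show ?case by (auto intro: pts.conversion beta_eq_lift)
qed

text \<open>\<open>N\<close> is typed over \<Gamma>, so \<open>N'\<close> lifts it past the
  declarations of \<Delta>. The \<open>axiom\<close> case is vacuous, as the context contains
  \<open>A\<close>.\<close>

lemma pts_substitution:
  assumes "pts S Ax R (\<Delta> @ A # \<Gamma>) M B" and N: "pts S Ax R \<Gamma> N A"
  defines "N' \<equiv> \<lambda>\<Delta>. (lift 0 ^^ length (\<Delta> :: 'c pterm list)) N"
  shows "pts S Ax R (subst_ctx N \<Delta> @ \<Gamma>) (subst (length \<Delta>) (N' \<Delta>) M) (subst (length \<Delta>) (N' \<Delta>) B)"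
  using assms(1)
proof (induction "\<Delta> @ A # \<Gamma>" M B arbitrary: \<Delta> rule: pts.induct)
  case (start \<Gamma>' C t)
  show ?case
  proof (cases \<Delta>)
    case Nil
    with start N show ?thesis by (simp add: N'_def)
  next
    case (Cons A' \<Delta>')
    with start pts.start[of S Ax R "subst_ctx N \<Delta>' @ \<Gamma>" "subst (length \<Delta>') (N' \<Delta>') C" t]
    show ?thesis by (simp add: N'_def lift_subst_le)
  qed
next
  case (weakening \<Gamma>' M B C t)
  show ?case
  proof (cases \<Delta>)
    case Nil
    with weakening show ?thesis by (simp add: N'_def)
  next
    case (Cons A' \<Delta>')
    with weakening show ?thesis
      using pts.weakening[of S Ax R "subst_ctx N \<Delta>' @ \<Gamma>" "subst (length \<Delta>') (N' \<Delta>') M"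
          "subst (length \<Delta>') (N' \<Delta>') B" "subst (length \<Delta>') (N' \<Delta>') C" t]
      by (simp add: N'_def lift_subst_le)
  qed
next
  case (application M C B P)
  then show ?case
    using pts.application[of S Ax R "subst_ctx N \<Delta> @ \<Gamma>"] by (fastforce simp: subst_subst)
next
  case (abstraction C M B t)
  from abstraction(2)[of "C # \<Delta>"] abstraction(4) abstraction(5) show ?case
    by (auto simp: N'_def intro: pts.abstraction)
next
  case (product C B s2 s1 s3)
  from product(2)[of "C # \<Delta>"] product(4) product(5) show ?case
    by (auto simp: N'_def intro: pts.product)
next
  case (conversion M C B t)
  then show ?case by (auto intro: pts.conversion beta_eq_subst)
qed simp

lemma pts_substitution_head:
  "\<lbrakk>pts S Ax R (A # \<Gamma>) M B; pts S Ax R \<Gamma> N A\<rbrakk> \<Longrightarrow> pts S Ax R \<Gamma> (subst 0 N M) (subst 0 N B)"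
  using pts_substitution[of S Ax R "[]"] by simp

lemma lift_eq_PrdD: "lift k M = Prd A B \<Longrightarrow> \<exists>A' B'. M = Prd A' B' \<and> A = lift k A' \<and> B = lift (Suc k) B'"
  by (cases M) (auto split: if_splits)

text \<open>The part of the generation lemma that concerns codomains. With \<open>C\<close>
  arbitrary the conversion case is immediate; weakening calls for thinning below the bound
  variable.\<close>

lemma pts_Prd_codomain:
  "pts S Ax R \<Gamma> (Prd A B) C \<Longrightarrow> \<exists>s1 s2 s3. pts S Ax R (A # \<Gamma>) B (Cst s2) \<and> (s1, s2, s3) \<in> R"
proof (induction \<Gamma> "Prd A B" C arbitrary: A B rule: pts.induct)
  case (weakening \<Gamma> M C D t)
  from weakening.hyps(6) obtain A' B' where
    M: "Prd A' B' = M" and AB: "A = lift 0 A'" "B = lift (Suc 0) B'"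
    by (metis lift_eq_PrdD)
  from weakening(2)[OF M[symmetric]] obtain s1 s2 s3 where
    "pts S Ax R ([A'] @ \<Gamma>) B' (Cst s2)" "(s1, s2, s3) \<in> R" by auto
  with pts_thinning[OF this(1) weakening.hyps(3,5)] show ?case by (auto simp: AB)
qed auto

text \<open>The first alternative covers sorts that have no type themselves. In the application case
  the product is no constant, so it has a sort, and its codomain is typed by the second component of
  a rule.\<close>

lemma pts_type_correct:
  assumes "R \<subseteq> S \<times> S \<times> S"
  shows "pts S Ax R \<Gamma> M A \<Longrightarrow> (\<exists>t. A = Cst t) \<or> (\<exists>t\<in>S. pts S Ax R \<Gamma> A (Cst t))"
proof (induction rule: pts.induct)
  case (start \<Gamma> A s)
  then show ?case using pts.weakening[OF start(1,1,2)] by auto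
next
  case (weakening \<Gamma> M B A s)
  from weakening.IH(1) show ?case
  proof (elim disjE exE bexE)
    fix t assume "t \<in> S" "pts S Ax R \<Gamma> B (Cst t)"
    with pts.weakening[OF this(2) weakening.hyps(2,3)] show ?thesis by auto
  qed auto
next
  case (application \<Gamma> M A B N)
  then obtain t where "pts S Ax R \<Gamma> (Prd A B) (Cst t)" by auto
  then obtain s1 s2 s3 where "pts S Ax R (A # \<Gamma>) B (Cst s2)" and r: "(s1, s2, s3) \<in> R"
    using pts_Prd_codomain by blast
  from pts_substitution_head[OF this(1) application.hyps(2)] r assms show ?case by auto
qed auto

text \<open>In the empty context only \<open>axiom\<close> and \<open>conversion\<close> can type a
  constant.\<close>

lemma pts_Cst_type: "pts S Ax R [] (Cst c) A \<Longrightarrow> \<exists>t. (c, t) \<in> Ax \<and> A =\<^sub>\<beta> Cst t"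
proof (induction "[] :: 'a pterm list" "Cst c" A rule: pts.induct)
  case (conversion A B s)
  then show ?case by (meson equivclp_sym equivclp_trans)
qed auto

section \<open>Product prefixes\<close>

fun pi_depth :: "'c pterm \<Rightarrow> nat" where
  "pi_depth (Prd A B) = Suc (pi_depth B)"
| "pi_depth _ = 0"

fun pi_core :: "'c pterm \<Rightarrow> 'c pterm" where
  "pi_core (Prd A B) = pi_core B"
| "pi_core M = M"

text \<open>A step can only take place in one of the domains. A core that is not normal could itself
  reduce to a product and lengthen the prefix.\<close>

lemma beta_pi_depth:
  "M \<rightarrow>\<^sub>\<beta> M' \<Longrightarrow> beta_normal (pi_core M) \<Longrightarrow> pi_depth M' = pi_depth M \<and> beta_normal (pi_core M')"
  by (induction rule: beta.induct) (auto simp: beta_normal_def intro: beta.intros)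

lemma betas_pi_depth:
  "beta\<^sup>*\<^sup>* M M' \<Longrightarrow> beta_normal (pi_core M) \<Longrightarrow> pi_depth M' = pi_depth M \<and> beta_normal (pi_core M')"
  by (induction rule: rtranclp_induct) (auto dest: beta_pi_depth)

lemma beta_normal_pi_core: "beta_normal M \<Longrightarrow> beta_normal (pi_core M)"
  by (induction M) (auto simp: beta_normal_def intro: beta.intros)

lemma pi_depth_lift [simp]: "pi_depth (lift k M) = pi_depth M"
  by (induction M arbitrary: k) auto

text \<open>The cutoff grows by one with each product crossed, hence some \<open>j\<close> in place
  of \<open>k\<close>.\<close>

lemma pi_core_lift: "\<exists>j. pi_core (lift k M) = lift j (pi_core M)"
proof (induction M arbitrary: k)
  case (Var i)
  show ?case by (rule exI[of _ k]) auto
qed auto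

lemma pi_depth_map [simp]: "pi_depth (map_pterm f M) = pi_depth M"
  by (induction M) auto

lemma pi_core_map [simp]: "pi_core (map_pterm f M) = map_pterm f (pi_core M)"
  by (induction M) auto

inductive_cases beta_VarE: "Var i \<rightarrow>\<^sub>\<beta> P"
inductive_cases beta_PrdE: "Prd A B \<rightarrow>\<^sub>\<beta> P"
inductive_cases beta_LamE: "Lam A M \<rightarrow>\<^sub>\<beta> P"
inductive_cases beta_AppE: "App M N \<rightarrow>\<^sub>\<beta> P"

lemma beta_normal_lift:
  assumes "beta_normal M"
  shows "beta_normal (lift k M)"
proof -
  have "\<exists>Q. M \<rightarrow>\<^sub>\<beta> Q" if "lift k M \<rightarrow>\<^sub>\<beta> P" for P
    using that
  proof (induction M arbitrary: k P)
    case (Var i)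
    then show ?case by (auto elim: beta_VarE split: if_splits)
  next
    case (App M N)
    from App.prems have "lift k M \<rightarrow>\<^sub>\<beta> P' \<Longrightarrow> ?case" for P'
      using App.IH(1) beta.App1 by blast
    \<comment> \<open>Lifting preserves the outermost constructor, so a redex after lifting was one
      before.\<close>
    moreover have ?case if "lift k M = Lam A M'" for A M'
      using that by (cases M) (auto intro: beta.intros split: if_splits)
    moreover have "lift k N \<rightarrow>\<^sub>\<beta> P' \<Longrightarrow> ?case" for P'
      using App.IH(2) beta.App2 by blast
    ultimately show ?case using App.prems by (auto elim!: beta_AppE)
  qed (auto elim!: beta_PrdE beta_LamE, (blast intro: beta.intros)+)
  with assms show ?thesis by (auto simp: beta_normal_def)
qed

section \<open>Reductions of schemes and of their instances\<close>

lemma beta_map_pterm: "M \<rightarrow>\<^sub>\<beta> N \<Longrightarrow> map_pterm f M \<rightarrow>\<^sub>\<beta> map_pterm f N"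
  by (induction rule: beta.induct) (auto simp: map_pterm_subst intro: beta.intros)

text \<open>Whether a subterm is a redex does not depend on the constants in it, so a step after
  replacing constants comes from a step before, even if \<open>f\<close> is not injective.\<close>

lemma beta_map_ptermD: "map_pterm f M \<rightarrow>\<^sub>\<beta> P \<Longrightarrow> \<exists>N. M \<rightarrow>\<^sub>\<beta> N \<and> P = map_pterm f N"
proof (induction M arbitrary: P)
  case (App M N)
  from App.prems have "App (map_pterm f M) (map_pterm f N) \<rightarrow>\<^sub>\<beta> P" by simp
  then show ?case
  proof (rule beta_AppE)
    fix A M' assume M': "map_pterm f M = Lam A M'" and P: "P = subst 0 (map_pterm f N) M'"
    from M' obtain A0 M0 where "M = Lam A0 M0" "M' = map_pterm f M0" by (cases M) auto
    with P show ?thesis by (metis beta.beta map_pterm_subst)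
  next
    fix M' assume "P = App M' (map_pterm f N)" "map_pterm f M \<rightarrow>\<^sub>\<beta> M'"
    with App.IH(1)[of M'] show ?thesis by (metis beta.App1 pterm.map(5))
  next
    fix N' assume "P = App (map_pterm f M) N'" "map_pterm f N \<rightarrow>\<^sub>\<beta> N'"
    with App.IH(2)[of N'] show ?thesis by (metis beta.App2 pterm.map(5))
  qed
next
  case (Prd A B)
  from Prd.prems show ?case
    by (auto elim!: beta_PrdE dest!: Prd.IH) (metis beta.Prd1 beta.Prd2 pterm.map(3))+
next
  case (Lam A M)
  from Lam.prems show ?case
    by (auto elim!: beta_LamE dest!: Lam.IH) (metis beta.Lam1 beta.Lam2 pterm.map(4))+
qed (auto elim: beta_VarE)

lemma betas_map_ptermD:
  "beta\<^sup>*\<^sup>* (map_pterm f M) P \<Longrightarrow> \<exists>N. beta\<^sup>*\<^sup>* M N \<and> P = map_pterm f N"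
proof (induction rule: rtranclp_induct)
  case (step P Q)
  then show ?case by (meson beta_map_ptermD rtranclp.rtrancl_into_rtrancl)
qed blast

text \<open>Both reductions are pulled back to the one scheme term \<open>M\<close>, where
  confluence applies although \<sigma> and \<tau> may differ.\<close>

lemma pi_depth_scheme_unique:
  assumes "beta\<^sup>*\<^sup>* (inst \<sigma> M) T" "beta_normal (pi_core T)"
    and "beta\<^sup>*\<^sup>* (inst \<tau> M) U" "beta_normal (pi_core U)"
  shows "pi_depth T = pi_depth U"
proof -
  have *: "beta_normal N" if "beta_normal (map_pterm f N)" for f :: "('c + nat) \<Rightarrow> 'c" and N
    using that beta_map_pterm by (auto simp: beta_normal_def)
  obtain T' where T': "beta\<^sup>*\<^sup>* M T'" "pi_depth T' = pi_depth T" "beta_normal (pi_core T')"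
    using assms(1,2) * by (fastforce simp: inst_def dest!: betas_map_ptermD)
  obtain U' where U': "beta\<^sup>*\<^sup>* M U'" "pi_depth U' = pi_depth U" "beta_normal (pi_core U')"
    using assms(3,4) * by (fastforce simp: inst_def dest!: betas_map_ptermD)
  obtain Q where "beta\<^sup>*\<^sup>* T' Q" "beta\<^sup>*\<^sup>* U' Q"
    using beta_confluent T'(1) U'(1) by blast
  with betas_pi_depth T' U' show ?thesis by metis
qed

section \<open>Inhabitants of the sort\<close>

text \<open>The type is only required to convert to \<open>Cst s\<close>, so that the induction
  passes conversion and type reduction.\<close>

lemma hpts_inhabitant_from_scheme:
  assumes eq: "hpts_equivalent S Ax \<B> R"
    and R: "R \<subseteq> S \<times> S \<times> S"
    and no_ax: "\<forall>s1 s2 s3. (s1, s2, s3) \<in> R \<longrightarrow> (s, s2) \<notin> Ax"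
  shows "hpts S Ax \<B> M C \<Longrightarrow> C =\<^sub>\<beta> Cst s \<Longrightarrow>
    (\<exists>c. M = Cst c) \<or> (\<exists>(M0, A0)\<in>\<B>. \<exists>\<sigma>. beta\<^sup>*\<^sup>* (inst \<sigma> M0) M)"
proof (induction rule: hpts.induct)
  case (application M A B N)
  have pts_iff: "pts S Ax R [] M A \<longleftrightarrow> hpts S Ax \<B> M A" for M A
    using eq by (simp add: hpts_equivalent_def)
  obtain t where "pts S Ax R [] (Prd A B) (Cst t)"
    using pts_type_correct[OF R] application.hyps(1) pts_iff by blast
  then obtain s1 s2 s3 where B: "pts S Ax R [A] B (Cst s2)" and r: "(s1, s2, s3) \<in> R"
    using pts_Prd_codomain by blast
  \<comment> \<open>Subject reduction is a rule of the Hilbert-style system; here it is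
    iterated.\<close>
  have subj: "hpts S Ax \<B> P A \<Longrightarrow> hpts S Ax \<B> Q A" if "beta\<^sup>*\<^sup>* P Q" for P Q A
    using that by (induction rule: rtranclp_induct) (auto intro: hpts.subject_reduction)
  have "hpts S Ax \<B> (subst 0 N B) (Cst s2)"
    using pts_substitution_head[OF B] application.hyps(2) pts_iff by fastforce
  \<comment> \<open>\<open>subst 0 N B\<close> is the type of the application, so it converts, and
    hence reduces, to \<open>Cst s\<close>.\<close>
  then have "hpts S Ax \<B> (Cst s) (Cst s2)"
    by (rule subj[OF beta_eq_Cst[OF application.prems]])
  then have "pts S Ax R [] (Cst s) (Cst s2)"
    by (simp only: pts_iff)
  from pts_Cst_type[OF this] obtain t where "(s, t) \<in> Ax" "Cst s2 =\<^sub>\<beta> Cst t"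
    by blast
  then have "(s, s2) \<in> Ax" by (auto dest: beta_eq_Cst)
  with no_ax r show ?case by blast
next
  case (conversion M A B t)
  from conversion.IH(1)[OF equivclp_trans[OF conversion.hyps(4) conversion.prems]] show ?case .
next
  case (type_reduction M A B)
  from type_reduction.hyps(2) have "A =\<^sub>\<beta> B" by (rule r_into_equivclp)
  from type_reduction.IH[OF equivclp_trans[OF this type_reduction.prems]] show ?case .
next
  case (subject_reduction M A N)
  from subject_reduction.IH[OF subject_reduction.prems] show ?case
  proof (elim disjE exE bexE)
    fix c assume "M = Cst c"
    with subject_reduction.hyps(2) show ?thesis by simp
  next
    fix p assume p: "p \<in> \<B>" "case p of (M0, A0) \<Rightarrow> \<exists>\<sigma>. beta\<^sup>*\<^sup>* (inst \<sigma> M0) M"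
    then obtain \<sigma> where "beta\<^sup>*\<^sup>* (inst \<sigma> (fst p)) M" by (auto simp: case_prod_unfold)
    with subject_reduction.hyps(2) have "beta\<^sup>*\<^sup>* (inst \<sigma> (fst p)) N" by simp
    with p(1) show ?thesis by (auto simp: case_prod_unfold)
  qed
next
  case (scheme M A \<sigma>)
  then show ?case by (auto intro!: bexI[of _ "(M, A)"] exI[of _ \<sigma>])
qed simp

text \<open>Each of the \<open>i\<close> steps along the cycle puts one more product in front, whose
  domain is an inhabitant of the sort \<open>s'\<close> of the rule.\<close>

lemma pi_depth_increase:
  assumes cycle: "\<forall>i. 1 \<le> i \<and> i < n \<longrightarrow> (\<exists>s'\<in>inhabited_sorts S Ax R. (s', s i, s (i + 1)) \<in> R)"
    and T: "pts S Ax R [] T (Cst (s 1))" "beta_normal (pi_core T)"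
    and i: "i < n"
  shows "\<exists>U. pts S Ax R [] U (Cst (s (Suc i))) \<and> beta_normal (pi_core U) \<and> pi_depth U = pi_depth T + i"
  using i
proof (induction i)
  case 0
  with T show ?case by auto
next
  case (Suc i)
  then obtain U where U: "pts S Ax R [] U (Cst (s (Suc i)))" "beta_normal (pi_core U)"
    "pi_depth U = pi_depth T + i" by auto
  from cycle Suc.prems obtain s' A where
    A: "s' \<in> S" "pts S Ax R [] A (Cst s')" and r: "(s', s (Suc i), s (Suc (Suc i))) \<in> R"
    by (force simp: inhabited_sorts_def)
  \<comment> \<open>The lifted \<open>U\<close> makes the new product non-dependent. As
    \<open>A\<close> may contain redexes, only the core is kept normal.\<close>
  have "pts S Ax R [A] (lift 0 U) (Cst (s (Suc i)))"
    using pts.weakening[OF U(1) A(2,1)] by simp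
  then have "pts S Ax R [] (Prd A (lift 0 U)) (Cst (s (Suc (Suc i))))"
    using A(2) r by (rule pts.product)
  moreover have "beta_normal (pi_core (Prd A (lift 0 U)))"
    using pi_core_lift[of 0 U] beta_normal_lift[OF U(2)] by auto
  ultimately show ?case using U(3) by fastforce
qed

section \<open>Pigeonhole on the finitely many schemes\<close>

theorem theorem14:
  fixes S :: "'c set" and Ax :: "('c \<times> 'c) set" and R :: "('c \<times> 'c \<times> 'c) set"
    and n :: nat and s :: "nat \<Rightarrow> 'c"
  assumes "pts_spec S Ax R"
    and "n > 1"
    and "\<forall>i\<in>{1..n}. s i \<in> S"
    and "s 1 = s n"
    and "s 1 \<in> nf_inhabited_sorts S Ax R"
    and "\<forall>i. 1 \<le> i \<and> i < n \<longrightarrow> (\<exists>s'\<in>inhabited_sorts S Ax R. (s', s i, s (i + 1)) \<in> R)"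
    and "\<forall>s1' s2' s3'. (s1', s2', s3') \<in> R \<longrightarrow> (s 1, s2') \<notin> Ax"
  shows "\<nexists>\<B>. hpts_spec S Ax \<B> \<and> hpts_equivalent S Ax \<B> R"
proof
  assume "\<exists>\<B>. hpts_spec S Ax \<B> \<and> hpts_equivalent S Ax \<B> R"
  then obtain \<B> where fin: "finite \<B>" and eq: "hpts_equivalent S Ax \<B> R"
    by (auto simp: hpts_spec_def)
  define good where
    "good T \<longleftrightarrow> pts S Ax R [] T (Cst (s 1)) \<and> beta_normal (pi_core T)" for T
  have unbounded: "\<exists>T. good T \<and> k \<le> pi_depth T" for k
  proof (induction k)
    case 0
    from assms(5) show ?case
      by (auto simp: nf_inhabited_sorts_def good_def intro: beta_normal_pi_core)
  next
    case (Suc k)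
    then obtain T where "good T" "k \<le> pi_depth T" by blast
    \<comment> \<open>A full round of \<open>n - 1\<close> steps leads from \<open>s 1\<close> to
      \<open>s n = s 1\<close> and adds at least one product, since \<open>n > 1\<close>.\<close>
    with pi_depth_increase[OF assms(6), of T "n - 1"] assms(2,4) show ?case
      by (fastforce simp: good_def)
  qed
  \<comment> \<open>Positive depth rules out the constants.\<close>
  have from_scheme: "\<exists>p\<in>\<B>. \<exists>\<sigma>. beta\<^sup>*\<^sup>* (inst \<sigma> (fst p)) T" if "good T" "0 < pi_depth T" for T
  proof -
    have "hpts S Ax \<B> T (Cst (s 1))"
      using that(1) eq by (simp add: good_def hpts_equivalent_def)
    moreover have "R \<subseteq> S \<times> S \<times> S" using assms(1) by (simp add: pts_spec_def)
    ultimately have "(\<exists>c. T = Cst c) \<or> (\<exists>(M0, A0)\<in>\<B>. \<exists>\<sigma>. beta\<^sup>*\<^sup>* (inst \<sigma> M0) T)"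
      by (intro hpts_inhabitant_from_scheme[OF eq _ assms(7)]) auto
    with that(2) show ?thesis by (auto simp: case_prod_unfold)
  qed
  define D where "D = {pi_depth T | T. good T \<and> 0 < pi_depth T}"
  define yields where
    "yields d p \<longleftrightarrow> (\<exists>\<sigma> T. good T \<and> pi_depth T = d \<and> beta\<^sup>*\<^sup>* (inst \<sigma> (fst p)) T)"
    for d and p :: "'c scheme"
  have "\<forall>d\<in>D. \<exists>p. p \<in> \<B> \<and> yields d p"
    using from_scheme by (fastforce simp: D_def yields_def)
  then obtain g where g: "\<And>d. d \<in> D \<Longrightarrow> g d \<in> \<B> \<and> yields d (g d)"
    by metis
  \<comment> \<open>One scheme yields only one depth, so \<open>g\<close> embeds \<open>D\<close>
    into the finite set \<B>, whereas the depths are unbounded.\<close>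
  have "inj_on g D"
  proof (rule inj_onI)
    fix d e assume "d \<in> D" "e \<in> D" "g d = g e"
    with g[of d] g[of e] show "d = e"
      by (auto simp: yields_def good_def dest: pi_depth_scheme_unique)
  qed
  with g fin have "finite D" by (metis finite_subset finite_imageD image_subsetI)
  moreover have "\<exists>d\<in>D. k < d" for k
    using unbounded[of "Suc k"] by (fastforce simp: D_def)
  ultimately show False
    by (meson finite_nat_set_iff_bounded order_less_asym)
qed

end
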